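(* Let $g_1,\dots,g_m,h_1,\dots,h_p:\mathbb{R}^n\to\mathbb{R}$ be $C^1$ functions, let $\mathcal{F}=\{x\in\mathbb{R}^n: g_i(x)\le 0\ \text{for all } i,\ h_j(x)=0\ \text{for all } j\}$ be non-empty, let $r(x)=\max\{\max_i (g_i(x))_+,\ \max_j |h_j(x)|\}$, and for $\delta\ge 0$ let $U_\delta=\{x\in\mathbb{R}^n: r(x)\le\delta\}$. Assume that the $g_i$ include a bounding constraint, so that $\mathcal{F}$ and every $U_\delta$ are compact. (A) Let $\delta_0>0$, $\theta\in(0,1]$, $\kappa>0$, and assume that the residual bound $\operatorname{dist}(x,\mathcal{F})\le\kappa\, r(x)^\theta$ holds for all $x\in U_{\delta_0}$. Let $0<\varepsilon\le\beta$ and let $x_c\in\mathbb{R}^n$ satisfy $r(x_c)\le\delta_0$. Then: (i) if $r(x_c)\le(\varepsilon/\kappa)^{1/\theta}$, there exists $x^\star\in\mathcal{F}$ with $\|x_c-x^\star\|_2\le\varepsilon$; (ii) if $r(x_c)\le(\beta/\kappa)^{1/\theta}$, then $\operatorname{dist}(x_c,\mathcal{F})\le\beta$, so there is a feasible point (a point of $\mathcal{F}$) within distance $\beta$ of $x_c$; (iii) if $r(x_c)>(\beta/\kappa)^{1/\theta}$, then the upper bound on $\operatorname{dist}(x_c,\mathcal{F})$ supplied by the residual bound satisfies $\kappa\, r(x_c)^\theta>\beta$, i.e. the residual bound does not certify the existence of a feasible point within distance $\beta$ of $x_c$. (B) At every $\bar x\in\mathcal{F}$ at which the Mangasarian--Fromovitz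 constraint qualification (MFCQ) holds, a local linear residual bound holds: there exist a neighborhood $V$ of $\bar x$ and $\kappa_{\bar x}>0$ such that $\operatorname{dist}(x,\mathcal{F})\le\kappa_{\bar x}\, r(x)$ for all $x\in V$. If MFCQ holds at every point of $\mathcal{F}$, then there exist an open set $V\supseteq\mathcal{F}$ and $\kappa>0$ such that $\operatorname{dist}(x,\mathcal{F})\le\kappa\, r(x)$ for all $x\in V$; moreover, for every fixed $\delta_0>0$ there exists $\kappa>0$ such that $\operatorname{dist}(x,\mathcal{F})\le\kappa\, r(x)$ for all $x\in U_{\delta_0}$. (C) If $\delta_0>0$ and $\mu>0$ are such that $r(x)\ge\mu\,\operatorname{dist}(x,\mathcal{F})^2$ for all $x\in U_{\delta_0}$, then $\operatorname{dist}(x,\mathcal{F})\le\mu^{-1/2}\, r(x)^{1/2}$ for all $x\in U_{\delta_0}$; that is, the residual bound holds on $U_{\delta_0}$ with $\theta=\tfrac12$ and $\kappa=\mu^{-1/2}$.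
   Context: Notation: $(t)_+=\max\{t,0\}$; $\|\cdot\|_2$ is the Euclidean norm on $\mathbb{R}^n$; $\operatorname{dist}(x,\mathcal{F})=\inf_{y\in\mathcal{F}}\|x-y\|_2$. The constraint families are finite. A bounding constraint is, for example, $\|x\|_2^2-R^2\le 0$ with $R>0$ appearing as one of the $g_i$; it also enters $r$. MFCQ at $\bar x\in\mathcal{F}$: the gradients $\nabla h_1(\bar x),\dots,\nabla h_p(\bar x)$ are linearly independent, and there is $d\in\mathbb{R}^n$ with $\nabla h_j(\bar x)^\top d=0$ for all $j$ and $\nabla g_i(\bar x)^\top d<0$ for every $i$ with $g_i(\bar x)=0$. *)

theory Defs
  imports "HOL-Analysis.Analysis"
begin

text \<open>
  A system of constraints consists of \<open>g\<^sub>1, \<dots>, g\<^sub>m\<close> (inequalities) and \<open>h\<^sub>1, \<dots>, h\<^sub>p\<close> (equalities);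
  the families are functions on \<open>nat\<close> of which only the indices in \<open>{1..m}\<close> and \<open>{1..p}\<close> matter.
  Either family may be empty.
\<close>

definition gradient :: "('a::real_inner \<Rightarrow> real) \<Rightarrow> 'a \<Rightarrow> 'a" where
  "gradient f x = (THE D. GDERIV f x :> D)"

lemma gradient_eq:
  assumes "GDERIV f x :> D"
  shows "gradient f x = D"
  unfolding gradient_def
proof (rule the_equality)
  show "GDERIV f x :> D" by (rule assms)
next
  fix E assume "GDERIV f x :> E"
  with assms have "(\<lambda>v. v \<bullet> E) = (\<lambda>v. v \<bullet> D)"
    unfolding gderiv_def by (rule has_derivative_unique[rotated])
  then have "v \<bullet> E = v \<bullet> D" for v by (rule fun_cong)
  then show "E = D" by (metis inner_commute vector_eq_ldot)
qed

definition C1_fun :: "('a::real_inner \<Rightarrow> real) \<Rightarrow> bool" where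
  "C1_fun f \<longleftrightarrow> (\<forall>x. GDERIV f x :> gradient f x) \<and> continuous_on UNIV (gradient f)"

definition feasible_set ::
  "nat \<Rightarrow> (nat \<Rightarrow> 'a \<Rightarrow> real) \<Rightarrow> nat \<Rightarrow> (nat \<Rightarrow> 'a \<Rightarrow> real) \<Rightarrow> 'a set" where
  "feasible_set m g p h = {x. (\<forall>i\<in>{1..m}. g i x \<le> 0) \<and> (\<forall>j\<in>{1..p}. h j x = 0)}"

text \<open>
  All the quantities being maximized are nonnegative, so inserting \<open>0\<close> only fixes the value \<open>0\<close> for
  the maximum over an empty family.
\<close>

definition residual ::
  "nat \<Rightarrow> (nat \<Rightarrow> 'a \<Rightarrow> real) \<Rightarrow> nat \<Rightarrow> (nat \<Rightarrow> 'a \<Rightarrow> real) \<Rightarrow> 'a \<Rightarrow> real" where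
  "residual m g p h x =
     max (Max (insert 0 ((\<lambda>i. max (g i x) 0) ` {1..m})))
         (Max (insert 0 ((\<lambda>j. \<bar>h j x\<bar>) ` {1..p})))"

definition residual_sublevel ::
  "nat \<Rightarrow> (nat \<Rightarrow> 'a \<Rightarrow> real) \<Rightarrow> nat \<Rightarrow> (nat \<Rightarrow> 'a \<Rightarrow> real) \<Rightarrow> real \<Rightarrow> 'a set" where
  "residual_sublevel m g p h \<delta> = {x. residual m g p h x \<le> \<delta>}"

text \<open>
  A bounding constraint is an inequality constraint that alone confines each relaxed set
  \<open>{x. g i x \<le> \<delta>}\<close>, \<open>\<delta> \<ge> 0\<close>, to a bounded region; the standard example is the Euclidean ball
  constraint below.
\<close>

definition has_bounding_constraint ::
  "nat \<Rightarrow> (nat \<Rightarrow> 'a::metric_space \<Rightarrow> real) \<Rightarrow> bool" where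
  "has_bounding_constraint m g \<longleftrightarrow> (\<exists>i\<in>{1..m}. \<forall>\<delta>\<ge>0. bounded {x. g i x \<le> \<delta>})"

lemma ball_constraint_bounding:
  fixes g :: "nat \<Rightarrow> 'a::real_normed_vector \<Rightarrow> real"
  assumes "i \<in> {1..m}" and "\<And>x. g i x = (norm x)\<^sup>2 - R\<^sup>2"
  shows "has_bounding_constraint m g"
  unfolding has_bounding_constraint_def
proof (intro bexI[OF _ assms(1)] allI impI)
  fix \<delta> :: real assume "\<delta> \<ge> 0"
  have "norm x \<le> sqrt (R\<^sup>2 + \<delta>)" if "g i x \<le> \<delta>" for x
    using that by (intro real_le_rsqrt) (simp add: assms(2))
  then show "bounded {x. g i x \<le> \<delta>}"
    by (auto simp: bounded_iff)
qed

text \<open>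
  Linear independence of the family of equality gradients: \<open>independent\<close> is about the set of
  vectors, so repetitions have to be excluded separately.
\<close>

definition MFCQ ::
  "nat \<Rightarrow> (nat \<Rightarrow> 'a::real_inner \<Rightarrow> real) \<Rightarrow> nat \<Rightarrow> (nat \<Rightarrow> 'a \<Rightarrow> real) \<Rightarrow> 'a \<Rightarrow> bool" where
  "MFCQ m g p h x \<longleftrightarrow>
     inj_on (\<lambda>j. gradient (h j) x) {1..p} \<and>
     independent ((\<lambda>j. gradient (h j) x) ` {1..p}) \<and>
     (\<exists>d. (\<forall>j\<in>{1..p}. gradient (h j) x \<bullet> d = 0) \<and>
          (\<forall>i\<in>{1..m}. g i x = 0 \<longrightarrow> gradient (g i) x \<bullet> d < 0))"

text \<open>
  \<open>infdist x F\<close> is the distance of \<open>x\<close> to \<open>F\<close> for nonempty \<open>F\<close>; since \<open>0 powr \<theta> = 0\<close>, the bound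
  has its usual meaning also where the residual vanishes.
\<close>

definition residual_bound_on ::
  "nat \<Rightarrow> (nat \<Rightarrow> 'a::metric_space \<Rightarrow> real) \<Rightarrow> nat \<Rightarrow> (nat \<Rightarrow> 'a \<Rightarrow> real) \<Rightarrow> real \<Rightarrow> real \<Rightarrow> 'a set \<Rightarrow> bool"
where
  "residual_bound_on m g p h \<kappa> \<theta> S \<longleftrightarrow>
     (\<forall>x\<in>S. infdist x (feasible_set m g p h) \<le> \<kappa> * residual m g p h x powr \<theta>)"

end

theory Submission
  imports Defs
begin

text \<open>
  Part (B) is a slope argument. Near a point where MFCQ holds, the residual \<open>r\<close> decreases at a
  rate at least \<open>c > 0\<close> from every infeasible \<open>y\<close>, along \<open>M d + w\<close>: here \<open>d\<close> is the MFCQ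
  direction, \<open>w\<close> is chosen by linear independence so that each \<open>\<bar>h\<^sub>j\<bar>\<close> decreases, and a large \<open>M\<close>
  makes the violated \<open>g\<^sub>i\<close> decrease as well. A minimizer of \<open>y \<mapsto> r y + c * dist x y\<close> is then
  feasible, and it lies within \<open>r x / c\<close> of \<open>x\<close>. Compactness makes the local bounds uniform.
\<close>

subsection \<open>The residual\<close>

text \<open>With this and the strict version below, most later arguments avoid the nested maxima.
  The conjunct \<open>0 \<le> b\<close> comes from the inserted \<open>0\<close>, and it is also
  what lets \<open>max (g i x) 0 \<le> b\<close> collapse to \<open>g i x \<le> b\<close>.\<close>

lemma residual_le_iff:
  "residual m g p h x \<le> b \<longleftrightarrow>
     0 \<le> b \<and> (\<forall>i\<in>{1..m}. g i x \<le> b) \<and> (\<forall>j\<in>{1..p}. \<bar>h j x\<bar> \<le> b)"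
  unfolding residual_def by auto

lemma residual_less_iff:
  "residual m g p h x < b \<longleftrightarrow>
     0 < b \<and> (\<forall>i\<in>{1..m}. g i x < b) \<and> (\<forall>j\<in>{1..p}. \<bar>h j x\<bar> < b)"
  unfolding residual_def by auto

lemma residual_nonneg: "0 \<le> residual m g p h x"
  using residual_le_iff[of m g p h x "residual m g p h x"] by simp

lemma constraint_le_residual: "i \<in> {1..m} \<Longrightarrow> g i x \<le> residual m g p h x"
  using residual_le_iff[of m g p h x "residual m g p h x"] by simp

lemma abs_constraint_le_residual: "j \<in> {1..p} \<Longrightarrow> \<bar>h j x\<bar> \<le> residual m g p h x"
  using residual_le_iff[of m g p h x "residual m g p h x"] by blast

lemma residual_eq_0_iff: "residual m g p h x = 0 \<longleftrightarrow> x \<in> feasible_set m g p h"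
proof -
  have "residual m g p h x = 0 \<longleftrightarrow> residual m g p h x \<le> 0"
    using residual_nonneg[of m g p h x] by linarith
  then show ?thesis
    by (simp add: residual_le_iff feasible_set_def)
qed

lemma residual_pos_iff: "0 < residual m g p h x \<longleftrightarrow> x \<notin> feasible_set m g p h"
  using residual_eq_0_iff[of m g p h x] residual_nonneg[of m g p h x] by linarith

text \<open>Induction on the index set: each new index contributes one binary maximum. The inserted
  \<open>a\<close> gives the empty family a constant value from which to start.\<close>

lemma continuous_on_Max_insert:
  fixes f :: "'i \<Rightarrow> 'a::topological_space \<Rightarrow> 'b::linorder_topology"
  assumes "finite I" and "\<And>i. i \<in> I \<Longrightarrow> continuous_on S (f i)"
  shows "continuous_on S (\<lambda>x. Max (insert a ((\<lambda>i. f i x) ` I)))"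
  using assms
proof (induction I)
  case (insert k I)
  have "Max (insert a ((\<lambda>i. f i x) ` insert k I)) =
      max (f k x) (Max (insert a ((\<lambda>i. f i x) ` I)))" for x
    using insert.hyps by (simp add: insert_commute[of a])
  then show ?case
    using insert by (auto intro!: continuous_on_max)
qed simp

lemma continuous_on_residual:
  assumes "\<And>i. i \<in> {1..m} \<Longrightarrow> continuous_on S (g i)"
    and "\<And>j. j \<in> {1..p} \<Longrightarrow> continuous_on S (h j)"
  shows "continuous_on S (residual m g p h)"
proof -
  have "continuous_on S (\<lambda>x. residual m g p h x)"
    unfolding residual_def
    using assms
    by (intro continuous_on_max continuous_on_Max_insert continuous_intros) auto
  then show ?thesis .
qed

section \<open>Continuity facts for continuously differentiable functions\<close>

lemma C1_fun_gderiv: "C1_fun f \<Longrightarrow> GDERIV f x :> gradient f x"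
  by (simp add: C1_fun_def)

lemma C1_fun_continuous_on: "C1_fun f \<Longrightarrow> continuous_on S f"
  by (meson C1_fun_gderiv gderiv_def has_derivative_continuous
      continuous_at_imp_continuous_on)

lemma C1_fun_isCont: "C1_fun f \<Longrightarrow> isCont f x"
  by (meson C1_fun_gderiv gderiv_def has_derivative_continuous)

lemma C1_fun_isCont_gradient: "C1_fun f \<Longrightarrow> isCont (gradient f) x"
  by (simp add: C1_fun_def continuous_on_eq_continuous_at)

subsection \<open>Error bounds from descent\<close>

text \<open>Compactness of closed balls supplies the minimizer that Ekeland's variational principle
  would give approximately in a complete space. Descent is needed only in the ball of radius
  \<open>\<phi> x / c\<close>, where the minimizer lies; this is what makes the lemma applicable
  locally.\<close>

lemma descent_imp_error_bound:
  fixes \<phi> :: "'a::heine_borel \<Rightarrow> real"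
  assumes cont: "continuous_on UNIV \<phi>" and nonneg: "\<And>x. 0 \<le> \<phi> x" and "0 < c"
    and descent: "\<And>y. dist x y \<le> \<phi> x / c \<Longrightarrow> 0 < \<phi> y \<Longrightarrow> \<exists>z. \<phi> z < \<phi> y - c * dist y z"
  shows "\<exists>y. \<phi> y = 0 \<and> c * dist x y \<le> \<phi> x"
proof -
  define \<psi> where "\<psi> y = \<phi> y + c * dist x y" for y
  define B where "B = cball x (\<phi> x / c)"
  have "x \<in> B"
    using nonneg[of x] \<open>0 < c\<close> by (simp add: B_def)
  moreover have "continuous_on B \<psi>"
    unfolding \<psi>_def
    by (intro continuous_intros continuous_on_subset[OF cont]) auto
  ultimately obtain y where y: "y \<in> B" "\<And>z. z \<in> B \<Longrightarrow> \<psi> y \<le> \<psi> z"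
    using continuous_attains_inf[of B \<psi>] by (auto simp: B_def)
  have "\<psi> y \<le> \<phi> x"
    using y(2)[OF \<open>x \<in> B\<close>] by (simp add: \<psi>_def)
  \<comment> \<open>Outside the ball the distance term alone exceeds \<open>\<phi> x\<close>. Global
    minimality is needed because the descent point \<open>z\<close> below may leave the
    ball.\<close>
  have global: "\<psi> y \<le> \<psi> z" for z
  proof (cases "z \<in> B")
    case False
    then have "\<phi> x < c * dist x z"
      using \<open>0 < c\<close> by (simp add: B_def field_simps)
    then show ?thesis
      using \<open>\<psi> y \<le> \<phi> x\<close> nonneg[of z] by (simp add: \<psi>_def)
  qed (rule y(2))
  have "\<not> 0 < \<phi> y"
  proof
    assume "0 < \<phi> y"
    then obtain z where "\<phi> z < \<phi> y - c * dist y z"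
      using descent y(1) by (auto simp: B_def)
    moreover have "c * dist x z \<le> c * (dist x y + dist y z)"
      using \<open>0 < c\<close> by (intro mult_left_mono dist_triangle) auto
    ultimately have "\<psi> z < \<psi> y"
      by (simp add: \<psi>_def algebra_simps)
    with global[of z] show False by simp
  qed
  then have "\<phi> y = 0"
    using nonneg[of y] by simp
  then show ?thesis
    using \<open>\<psi> y \<le> \<phi> x\<close> by (auto simp: \<psi>_def)
qed

text \<open>After moving \<open>c * t\<close> to the left, this is strict decrease at
  \<open>0\<close> of a function of one variable with negative derivative. It serves the violated
  constraints, with \<open>a\<close> the residual at \<open>y\<close>.\<close>

lemma eventually_descent_along:
  fixes f :: "'a::real_inner \<Rightarrow> real"
  assumes "GDERIV f y :> D" and "f y \<le> a" and "D \<bullet> v < - c"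
  shows "\<forall>\<^sub>F t in at_right 0. f (y + t *\<^sub>R v) < a - c * t"
proof -
  have "((\<lambda>t. f (y + t *\<^sub>R v)) has_derivative (\<lambda>t. (t *\<^sub>R v) \<bullet> D)) (at 0)"
  proof (rule has_derivative_compose[where g = f])
    show "((\<lambda>t. y + t *\<^sub>R v) has_derivative (\<lambda>t. t *\<^sub>R v)) (at (0::real))"
      by (auto intro!: derivative_eq_intros)
    show "(f has_derivative (\<lambda>w. w \<bullet> D)) (at (y + 0 *\<^sub>R v))"
      using assms(1) by (simp add: gderiv_def)
  qed
  then have "((\<lambda>t. f (y + t *\<^sub>R v)) has_real_derivative D \<bullet> v) (at 0)"
    unfolding has_field_derivative_def
    by (rule has_derivative_eq_rhs) (auto simp: inner_commute)
  then have "((\<lambda>t. f (y + t *\<^sub>R v) + c * t) has_real_derivative D \<bullet> v + c) (at 0)"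
    by (auto intro!: derivative_eq_intros)
  then obtain e where "e > 0" and
    e: "\<And>t. 0 < t \<Longrightarrow> t < e \<Longrightarrow> f (y + t *\<^sub>R v) + c * t < f y"
    using DERIV_neg_dec_right[of "\<lambda>t. f (y + t *\<^sub>R v) + c * t" "D \<bullet> v + c" 0] assms(3)
    by auto
  show ?thesis
    unfolding eventually_at_right_field
    using \<open>e > 0\<close> e assms(2) by (intro exI[of _ e]) fastforce
qed

text \<open>The complementary case: a function strictly below \<open>a\<close> has slack, so
  continuity suffices and nothing is asked of its slope.\<close>

lemma eventually_less_along:
  fixes f :: "'a::real_normed_vector \<Rightarrow> real"
  assumes "isCont f y" and "f y < a"
  shows "\<forall>\<^sub>F t in at_right 0. f (y + t *\<^sub>R v) < a - c * t"
proof -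
  have "((\<lambda>t::real. y + t *\<^sub>R v) \<longlongrightarrow> y + 0 *\<^sub>R v) (at_right 0)"
    by (intro tendsto_intros)
  then have "((\<lambda>t. f (y + t *\<^sub>R v)) \<longlongrightarrow> f y) (at_right 0)"
    using assms(1) by (intro isCont_tendsto_compose[of y f]) auto
  then have "((\<lambda>t. f (y + t *\<^sub>R v) + c * t) \<longlongrightarrow> f y + c * 0) (at_right 0)"
    by (intro tendsto_intros)
  then have "\<forall>\<^sub>F t in at_right 0. f (y + t *\<^sub>R v) + c * t < a"
    using assms(2) by (intro order_tendstoD(2)) auto
  then show ?thesis
    by eventually_elim simp
qed

text \<open>Every violated constraint has slope below \<open>- c\<close>, and every other one is at
  most \<open>0\<close>, hence strictly below the residual. Asking for the slope at all violated
  constraints avoids singling out those that attain the maximum.\<close>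

lemma residual_descent:
  fixes g h :: "nat \<Rightarrow> 'a::real_inner \<Rightarrow> real"
  assumes g: "\<And>i. i \<in> {1..m} \<Longrightarrow> C1_fun (g i)" and h: "\<And>j. j \<in> {1..p} \<Longrightarrow> C1_fun (h j)"
    and pos: "0 < residual m g p h y"
    and gv: "\<And>i. i \<in> {1..m} \<Longrightarrow> 0 < g i y \<Longrightarrow> gradient (g i) y \<bullet> v < - c"
    and hv: "\<And>j. j \<in> {1..p} \<Longrightarrow> h j y \<noteq> 0 \<Longrightarrow> sgn (h j y) * (gradient (h j) y \<bullet> v) < - c"
  shows "\<exists>t>0. residual m g p h (y + t *\<^sub>R v) < residual m g p h y - c * t"
proof -
  define r where "r = residual m g p h y"
  have "r > 0" using pos by (simp add: r_def)
  have ev_g: "\<forall>\<^sub>F t in at_right 0. g i (y + t *\<^sub>R v) < r - c * t" if i: "i \<in> {1..m}" for i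
  proof (cases "0 < g i y")
    case True
    have "g i y \<le> r"
      using i by (simp add: r_def constraint_le_residual)
    then show ?thesis
      using eventually_descent_along[OF C1_fun_gderiv[OF g[OF i]]] gv[OF i True] by blast
  next
    case False
    then show ?thesis
      using eventually_less_along[OF C1_fun_isCont[OF g[OF i]]] \<open>r > 0\<close> by simp
  qed
  \<comment> \<open>The absolute value is split into the smooth functions \<open>s * h j\<close>
    with \<open>s = 1\<close> and \<open>s = - 1\<close>. Only the one that is positive at
    \<open>y\<close> needs the slope condition.\<close>
  have ev_h: "\<forall>\<^sub>F t in at_right 0. s * h j (y + t *\<^sub>R v) < r - c * t"
    if j: "j \<in> {1..p}" and s: "\<bar>s\<bar> = 1" for j s
  proof (cases "0 < s * h j y")
    case True
    have "GDERIV (\<lambda>x. s * h j x) y :> s *\<^sub>R gradient (h j) y"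
      using C1_fun_gderiv[OF h[OF j], of y] unfolding gderiv_def
      by (auto intro!: derivative_eq_intros)
    moreover have "s * h j y \<le> r"
      using abs_constraint_le_residual[OF j, of h y m g] s by (auto simp: r_def abs_if split: if_splits)
    moreover have "s = sgn (h j y)" "h j y \<noteq> 0"
      using True s by (auto simp: abs_if sgn_if split: if_splits)
    then have "(s *\<^sub>R gradient (h j) y) \<bullet> v < - c"
      using hv[OF j] by simp
    ultimately show ?thesis
      using eventually_descent_along[of "\<lambda>x. s * h j x"] by blast
  next
    case False
    have "isCont (\<lambda>x. s * h j x) y"
      using C1_fun_isCont[OF h[OF j]] by (intro continuous_intros) auto
    then show ?thesis
      using eventually_less_along[of y "\<lambda>x. s * h j x" r v c] False \<open>r > 0\<close> by simp
  qed
  \<comment> \<open>The conjunct \<open>0 < r - c * t\<close> is there because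
    \<open>residual_less_iff\<close> demands a positive bound.\<close>
  have "\<forall>\<^sub>F t in at_right 0. (\<forall>i\<in>{1..m}. g i (y + t *\<^sub>R v) < r - c * t) \<and>
      (\<forall>j\<in>{1..p}. 1 * h j (y + t *\<^sub>R v) < r - c * t) \<and>
      (\<forall>j\<in>{1..p}. - 1 * h j (y + t *\<^sub>R v) < r - c * t) \<and> 0 < r - c * t \<and> 0 < t"
    using \<open>r > 0\<close> eventually_less_along[of y "\<lambda>_. 0" r v c]
    by (intro eventually_conj eventually_ball_finite ballI ev_g ev_h)
      (auto simp: eventually_at_right_less)
  then have "\<forall>\<^sub>F t in at_right 0. 0 < t \<and> residual m g p h (y + t *\<^sub>R v) < r - c * t"
    by eventually_elim (auto simp: residual_less_iff abs_less_iff)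
  from eventually_happens'[OF trivial_limit_at_right_real this] show ?thesis
    by (simp add: r_def)
qed

subsection \<open>Descent under MFCQ\<close>

text \<open>Values prescribed on an independent set extend to a linear functional, and
  \<open>adjoint f 1\<close> is its Riesz representative. Injectivity lets \<open>inv_into\<close>
  recover the index from the vector.\<close>

lemma independent_inner_solvable:
  fixes a :: "'i \<Rightarrow> 'a::euclidean_space"
  assumes "inj_on a I" and "independent (a ` I)"
  shows "\<exists>w. \<forall>j\<in>I. a j \<bullet> w = s j"
proof -
  obtain f :: "'a \<Rightarrow> real" where "linear f"
    and f: "\<And>x. x \<in> a ` I \<Longrightarrow> f x = s (inv_into I a x)"
    using linear_independent_extend[OF assms(2), of "\<lambda>x. s (inv_into I a x)"] by auto
  have "a j \<bullet> adjoint f 1 = s j" if "j \<in> I" for j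
    using adjoint_works[OF \<open>linear f\<close>, of "a j" 1] f[of "a j"] that assms(1)
    by (simp add: inner_commute)
  then show ?thesis by blast
qed

text \<open>The two requirements decouple: \<open>w\<close> realizes the prescribed equality slopes,
  and since \<open>d\<close> is orthogonal to the equality gradients, adding any multiple of
  \<open>d\<close> preserves them.\<close>

lemma MFCQ_direction:
  fixes g h :: "nat \<Rightarrow> 'a::euclidean_space \<Rightarrow> real"
  assumes "MFCQ m g p h x"
  shows "\<exists>v. (\<forall>i\<in>{1..m}. g i x = 0 \<longrightarrow> gradient (g i) x \<bullet> v \<le> - 1) \<and>
             (\<forall>j\<in>{1..p}. gradient (h j) x \<bullet> v = s j)"
proof -
  from assms obtain d where
    dh: "\<And>j. j \<in> {1..p} \<Longrightarrow> gradient (h j) x \<bullet> d = 0" and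
    dg: "\<And>i. i \<in> {1..m} \<Longrightarrow> g i x = 0 \<Longrightarrow> gradient (g i) x \<bullet> d < 0"
    unfolding MFCQ_def by blast
  from assms obtain w where w: "\<And>j. j \<in> {1..p} \<Longrightarrow> gradient (h j) x \<bullet> w = s j"
    unfolding MFCQ_def
    using independent_inner_solvable[of "\<lambda>j. gradient (h j) x" "{1..p}" s] by blast
  have "\<forall>\<^sub>F M in at_top. gradient (g i) x \<bullet> (M *\<^sub>R d + w) \<le> - 1"
    if "i \<in> {1..m}" "g i x = 0" for i
    \<comment> \<open>This threshold solves the required inequality for \<open>M\<close>; the
      denominator is positive by the choice of \<open>d\<close>.\<close>
    using eventually_ge_at_top[of "(1 + gradient (g i) x \<bullet> w) / - (gradient (g i) x \<bullet> d)"]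
    by eventually_elim (use dg[OF that] in \<open>simp add: field_simps inner_add_right\<close>)
  then have "\<forall>\<^sub>F M in at_top. \<forall>i\<in>{i\<in>{1..m}. g i x = 0}. gradient (g i) x \<bullet> (M *\<^sub>R d + w) \<le> - 1"
    by (intro eventually_ball_finite) auto
  from eventually_happens'[OF trivial_limit_at_top_linorder this] obtain M
    where "\<forall>i\<in>{i\<in>{1..m}. g i x = 0}. gradient (g i) x \<bullet> (M *\<^sub>R d + w) \<le> - 1" ..
  then show ?thesis
    using w dh by (intro exI[of _ "M *\<^sub>R d + w"]) (auto simp: inner_add_right)
qed

text \<open>The slopes along \<open>v s\<close> are known at \<open>x\<close> itself; continuity of
  the gradients carries them to nearby \<open>y\<close> at the price of weakening \<open>1\<close>
  to \<open>1 / 2\<close>. Dividing by a bound \<open>L\<close> on the lengths of the directions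
  gives the rate \<open>1 / (2 * L)\<close>.\<close>

lemma MFCQ_local_descent:
  fixes g h :: "nat \<Rightarrow> 'a::euclidean_space \<Rightarrow> real"
  assumes g: "\<And>i. i \<in> {1..m} \<Longrightarrow> C1_fun (g i)" and h: "\<And>j. j \<in> {1..p} \<Longrightarrow> C1_fun (h j)"
    and feasible: "x \<in> feasible_set m g p h" and "MFCQ m g p h x"
  shows "\<exists>c>0. \<forall>\<^sub>F y in nhds x. 0 < residual m g p h y \<longrightarrow>
    (\<exists>z. residual m g p h z < residual m g p h y - c * dist y z)"
proof -
  \<comment> \<open>The sign patterns of \<open>(- sgn (h j y))\<^sub>j\<close>: since there are finitely many, one neighborhood of \<open>x\<close>
    and one bound on the directions \<open>v s\<close> serve for all of them.\<close>
  define S where "S = {1..p} \<rightarrow>\<^sub>E {- 1, 0, 1 :: real}"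
  have "finite S"
    unfolding S_def by (intro finite_PiE) auto
  obtain v where
    vg: "\<And>s i. i \<in> {1..m} \<Longrightarrow> g i x = 0 \<Longrightarrow> gradient (g i) x \<bullet> v s \<le> - 1" and
    vh: "\<And>s j. j \<in> {1..p} \<Longrightarrow> gradient (h j) x \<bullet> v s = s j"
    using MFCQ_direction[OF \<open>MFCQ m g p h x\<close>] by metis
  \<comment> \<open>The sum dominates each single norm; the summand \<open>1\<close> keeps
    \<open>L\<close> positive even if all directions vanish.\<close>
  define L where "L = 1 + (\<Sum>s\<in>S. norm (v s))"
  have "L > 0"
    unfolding L_def by (simp add: add_pos_nonneg sum_nonneg)
  have v_le: "norm (v s) \<le> L" if "s \<in> S" for s
    unfolding L_def using member_le_sum[OF that, of "\<lambda>s. norm (v s)"] \<open>finite S\<close> by simp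
  have tendsto_gradient: "((\<lambda>y. gradient f y \<bullet> w) \<longlongrightarrow> gradient f x \<bullet> w) (nhds x)"
    if "C1_fun f" for f :: "'a \<Rightarrow> real" and w
    by (intro tendsto_intros isCont_tendsto_compose[OF C1_fun_isCont_gradient[OF that]])
      (rule filterlim_ident)
  have ev_g: "\<forall>\<^sub>F y in nhds x. 0 < g i y \<longrightarrow> gradient (g i) y \<bullet> v s < - (1 / 2)"
    if i: "i \<in> {1..m}" for i s
  proof (cases "g i x = 0")
    case True
    have "\<forall>\<^sub>F y in nhds x. gradient (g i) y \<bullet> v s < - (1 / 2)"
      using vg[OF i True, of s] by (intro order_tendstoD(2)[OF tendsto_gradient[OF g[OF i]]]) simp
    then show ?thesis
      by eventually_elim simp
  next
    \<comment> \<open>An inactive inequality remains negative near \<open>x\<close>, so the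
      implication holds vacuously there.\<close>
    case False
    then have "g i x < 0"
      using feasible i by (force simp: feasible_set_def)
    moreover have "(g i \<longlongrightarrow> g i x) (nhds x)"
      using isCont_tendsto_compose[OF C1_fun_isCont[OF g[OF i]] filterlim_ident] by simp
    ultimately have "\<forall>\<^sub>F y in nhds x. g i y < 0"
      by (intro order_tendstoD(2))
    then show ?thesis
      by eventually_elim simp
  qed
  have ev_h: "\<forall>\<^sub>F y in nhds x. s j \<noteq> 0 \<longrightarrow> 1 / 2 < s j * (gradient (h j) y \<bullet> v s)"
    if "s \<in> S" and j: "j \<in> {1..p}" for s j
  proof (cases "s j = 0")
    case False
    moreover have "s j \<in> {- 1, 0, 1}"
      using that by (auto simp only: S_def PiE_iff)
    \<comment> \<open>The slope at \<open>x\<close> is \<open>s j\<close>, so the product is the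
      square of \<open>1\<close> or \<open>- 1\<close>.\<close>
    ultimately have "s j * (gradient (h j) x \<bullet> v s) = 1"
      by (auto simp only: vh[OF j])
    moreover have "((\<lambda>y. s j * (gradient (h j) y \<bullet> v s)) \<longlongrightarrow>
        s j * (gradient (h j) x \<bullet> v s)) (nhds x)"
      by (intro tendsto_intros tendsto_gradient h j)
    ultimately have "\<forall>\<^sub>F y in nhds x. 1 / 2 < s j * (gradient (h j) y \<bullet> v s)"
      by (intro order_tendstoD(1)) auto
    then show ?thesis
      by eventually_elim simp
  qed simp
  have "\<forall>\<^sub>F y in nhds x. \<forall>s\<in>S.
      (\<forall>i\<in>{1..m}. 0 < g i y \<longrightarrow> gradient (g i) y \<bullet> v s < - (1 / 2)) \<and>
      (\<forall>j\<in>{1..p}. s j \<noteq> 0 \<longrightarrow> 1 / 2 < s j * (gradient (h j) y \<bullet> v s))"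
    by (intro eventually_ball_finite ballI eventually_conj ev_g ev_h \<open>finite S\<close>) auto
  then have "\<forall>\<^sub>F y in nhds x. 0 < residual m g p h y \<longrightarrow>
    (\<exists>z. residual m g p h z < residual m g p h y - 1 / (2 * L) * dist y z)"
  proof eventually_elim
    case (elim y)
    show ?case
    proof
      assume pos: "0 < residual m g p h y"
      \<comment> \<open>The restriction makes \<open>s\<close> an element of the extensional product
        \<open>S\<close>.\<close>
      define s where "s = restrict (\<lambda>j. - sgn (h j y)) {1..p}"
      have "s \<in> S"
        by (auto simp: s_def S_def sgn_if)
      have "\<exists>t>0. residual m g p h (y + t *\<^sub>R v s) < residual m g p h y - 1 / 2 * t"
      proof (rule residual_descent[OF g h pos])
        show "gradient (g i) y \<bullet> v s < - (1 / 2)" if "i \<in> {1..m}" "0 < g i y" for i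
          using elim \<open>s \<in> S\<close> that by blast
        show "sgn (h j y) * (gradient (h j) y \<bullet> v s) < - (1 / 2)"
          if "j \<in> {1..p}" "h j y \<noteq> 0" for j
        proof -
          have sj: "s j = - sgn (h j y)"
            using that(1) by (simp add: s_def)
          then have "s j \<noteq> 0"
            using that(2) by (simp add: sgn_eq_0_iff)
          then have "1 / 2 < s j * (gradient (h j) y \<bullet> v s)"
            using elim \<open>s \<in> S\<close> that(1) by blast
          then show ?thesis
            by (simp add: sj)
        qed
      qed
      then obtain t where "t > 0" and
        t: "residual m g p h (y + t *\<^sub>R v s) < residual m g p h y - 1 / 2 * t"
        by blast
      \<comment> \<open>Here the decrease per unit of \<open>t\<close> becomes a decrease per unit
        of distance.\<close>
      have "dist y (y + t *\<^sub>R v s) = t * norm (v s)"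
        using \<open>t > 0\<close> by (simp add: dist_norm)
      also have "\<dots> \<le> t * L"
        using \<open>t > 0\<close> v_le[OF \<open>s \<in> S\<close>] by (intro mult_left_mono) auto
      finally have "1 / (2 * L) * dist y (y + t *\<^sub>R v s) \<le> 1 / 2 * t"
        using \<open>L > 0\<close> by (simp add: field_simps)
      with t show "\<exists>z. residual m g p h z < residual m g p h y - 1 / (2 * L) * dist y z"
        by (intro exI[of _ "y + t *\<^sub>R v s"]) linarith
    qed
  qed
  then show ?thesis
    using \<open>L > 0\<close> by (intro exI[of _ "1 / (2 * L)"]) auto
qed

lemma MFCQ_local_error_bound:
  fixes g h :: "nat \<Rightarrow> 'a::euclidean_space \<Rightarrow> real"
  assumes g: "\<And>i. i \<in> {1..m} \<Longrightarrow> C1_fun (g i)" and h: "\<And>j. j \<in> {1..p} \<Longrightarrow> C1_fun (h j)"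
    and feasible: "x \<in> feasible_set m g p h" and "MFCQ m g p h x"
  shows "\<exists>V. open V \<and> x \<in> V \<and>
    (\<exists>\<kappa>>0. \<forall>y\<in>V. infdist y (feasible_set m g p h) \<le> \<kappa> * residual m g p h y)"
proof -
  define r where "r = residual m g p h"
  have cont: "continuous_on UNIV r"
    unfolding r_def by (intro continuous_on_residual C1_fun_continuous_on g h)
  obtain c N where "c > 0" and "open N" "x \<in> N" and
    descent: "\<And>y. y \<in> N \<Longrightarrow> 0 < r y \<Longrightarrow> \<exists>z. r z < r y - c * dist y z"
    using MFCQ_local_descent[OF assms] unfolding r_def eventually_nhds by blast
  obtain e where "e > 0" and e: "ball x e \<subseteq> N"
    using \<open>open N\<close> \<open>x \<in> N\<close> open_contains_ball by blast
  \<comment> \<open>Descent is available only in the ball of radius \<open>e\<close> around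
    \<open>x\<close>. For \<open>y\<close> in \<open>V\<close>, the ball of radius
    \<open>r y / c\<close> around \<open>y\<close>, where the minimization takes place, lies inside
    it.\<close>
  define V where "V = {y. dist x y + r y / c < e}"
  have "open V"
    unfolding V_def
    by (intro open_Collect_less continuous_intros cont) (use \<open>c > 0\<close> in auto)
  moreover have "x \<in> V"
    using feasible \<open>e > 0\<close> by (simp add: V_def r_def flip: residual_eq_0_iff)
  moreover have "infdist y (feasible_set m g p h) \<le> 1 / c * r y" if "y \<in> V" for y
  proof -
    have "\<exists>z. r z = 0 \<and> c * dist y z \<le> r y"
    proof (rule descent_imp_error_bound[OF cont _ \<open>c > 0\<close>])
      show "0 \<le> r z" for z
        by (simp add: r_def residual_nonneg)
      fix z assume "dist y z \<le> r y / c" "0 < r z"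
      then have "dist x z < e"
        using that dist_triangle[of x z y] by (simp add: V_def)
      then show "\<exists>w. r w < r z - c * dist z w"
        using descent e \<open>0 < r z\<close> by auto
    qed
    then obtain z where "z \<in> feasible_set m g p h" "c * dist y z \<le> r y"
      by (auto simp: r_def residual_eq_0_iff)
    then show ?thesis
      using order_trans[OF mult_left_mono[OF infdist_le[of z "feasible_set m g p h" y]]] \<open>c > 0\<close>
      by (simp add: field_simps)
  qed
  ultimately show ?thesis
    using \<open>c > 0\<close> unfolding r_def by (intro exI[of _ V]) (auto intro!: exI[of _ "1 / c"])
qed

subsection \<open>Uniform bounds on compact sets\<close>

text \<open>A finite subcover leaves finitely many constants, and their sum dominates each of them.
  Nonnegativity of \<open>b\<close> allows the constant to be enlarged.\<close>

lemma compact_local_bound_imp_uniform: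
  fixes a b :: "'a::topological_space \<Rightarrow> real"
  assumes "compact K" and nonneg: "\<And>x. 0 \<le> b x"
    and local: "\<And>x. x \<in> K \<Longrightarrow> \<exists>V. open V \<and> x \<in> V \<and> (\<exists>\<kappa>>0. \<forall>y\<in>V. a y \<le> \<kappa> * b y)"
  shows "\<exists>V. open V \<and> K \<subseteq> V \<and> (\<exists>\<kappa>>0. \<forall>y\<in>V. a y \<le> \<kappa> * b y)"
proof -
  obtain V \<kappa> where V: "\<And>x. x \<in> K \<Longrightarrow> open (V x)" "\<And>x. x \<in> K \<Longrightarrow> x \<in> V x"
    and \<kappa>: "\<And>x. x \<in> K \<Longrightarrow> 0 < \<kappa> x" "\<And>x y. x \<in> K \<Longrightarrow> y \<in> V x \<Longrightarrow> a y \<le> \<kappa> x * b y"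
    using local by metis
  obtain T where T: "T \<subseteq> K" "finite T" "K \<subseteq> (\<Union>x\<in>T. V x)"
    using compactE_image[OF \<open>compact K\<close>, of K V] V by blast
  \<comment> \<open>The summand \<open>1\<close> keeps the constant positive when the subcover is
    empty.\<close>
  define k where "k = 1 + (\<Sum>x\<in>T. \<kappa> x)"
  have "k > 0"
    unfolding k_def using \<kappa>(1) T(1) by (intro add_pos_nonneg sum_nonneg) (auto intro: less_imp_le)
  have "a y \<le> k * b y" if "x \<in> T" "y \<in> V x" for x y
  proof -
    have "\<kappa> x \<le> (\<Sum>x\<in>T. \<kappa> x)"
      using that(1) T(1,2) \<kappa>(1) by (intro member_le_sum) (auto intro: less_imp_le)
    then have "\<kappa> x * b y \<le> k * b y"
      unfolding k_def by (intro mult_right_mono nonneg) simp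
    then show ?thesis
      using \<kappa>(2)[of x y] that T(1) by force
  qed
  then show ?thesis
    using V(1) T(1,3) \<open>k > 0\<close> by (intro exI[of _ "\<Union>x\<in>T. V x"]) blast
qed

text \<open>Away from \<open>V\<close> the quotient \<open>a x / b x\<close> is continuous on a
  compact set, hence bounded. In the application \<open>V\<close> contains the feasible set, so the
  residual is positive on the remaining part.\<close>

lemma extend_bound_to_compact:
  fixes a b :: "'a::t2_space \<Rightarrow> real"
  assumes "compact K" and cont: "continuous_on K a" "continuous_on K b"
    and nonneg: "\<And>x. 0 \<le> b x" and "open V" and "0 < \<kappa>" and V: "\<And>x. x \<in> V \<Longrightarrow> a x \<le> \<kappa> * b x"
    and pos: "\<And>x. x \<in> K - V \<Longrightarrow> 0 < b x"
  shows "\<exists>\<kappa>>0. \<forall>x\<in>K. a x \<le> \<kappa> * b x"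
proof -
  have "compact (K - V)"
    using \<open>compact K\<close> \<open>open V\<close> by (rule compact_diff)
  moreover have "continuous_on (K - V) (\<lambda>x. a x / b x)"
    using pos by (intro continuous_intros continuous_on_subset[OF cont(1)]
        continuous_on_subset[OF cont(2)]) force+
  ultimately have "bounded ((\<lambda>x. a x / b x) ` (K - V))"
    by (intro compact_imp_bounded compact_continuous_image)
  then obtain B where B: "\<And>x. x \<in> K - V \<Longrightarrow> \<bar>a x / b x\<bar> \<le> B"
    unfolding bounded_iff by auto
  \<comment> \<open>Taking the maximum with \<open>\<kappa>\<close> also ensures positivity: nothing
    is known of \<open>B\<close> when \<open>K - V\<close> is empty.\<close>
  have "a x \<le> max \<kappa> B * b x" if "x \<in> K" for x
  proof (cases "x \<in> V")
    case True
    have "\<kappa> * b x \<le> max \<kappa> B * b x"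
      by (intro mult_right_mono nonneg) simp
    then show ?thesis
      using V[OF True] by linarith
  next
    case False
    then have "a x / b x \<le> max \<kappa> B"
      using abs_le_D1[OF B[of x]] that by (simp add: le_max_iff_disj)
    then show ?thesis
      using pos[of x] that False by (simp add: pos_divide_le_eq)
  qed
  then show ?thesis
    using \<open>0 < \<kappa>\<close> by (intro exI[of _ "max \<kappa> B"]) auto
qed

lemma bounded_residual_sublevel:
  assumes "has_bounding_constraint m g" and "0 \<le> \<delta>"
  shows "bounded (residual_sublevel m g p h \<delta>)"
proof -
  obtain i where "i \<in> {1..m}" and i: "bounded {x. g i x \<le> \<delta>}"
    using assms unfolding has_bounding_constraint_def by blast
  then have "residual_sublevel m g p h \<delta> \<subseteq> {x. g i x \<le> \<delta>}"
    by (auto simp: residual_sublevel_def residual_le_iff)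
  with i show ?thesis
    by (rule bounded_subset)
qed

text \<open>Translates the thresholds of part (A) into values of the residual bound. One direction
  serves (i) and (ii), and the contrapositive of the other serves (iii).\<close>

lemma le_powr_inverse_iff:
  fixes x y \<theta> :: real
  assumes "0 \<le> x" "0 \<le> y" "0 < \<theta>"
  shows "x \<le> y powr (1 / \<theta>) \<longleftrightarrow> x powr \<theta> \<le> y"
proof
  assume "x \<le> y powr (1 / \<theta>)"
  then have "x powr \<theta> \<le> (y powr (1 / \<theta>)) powr \<theta>"
    using assms by (intro powr_mono2) auto
  then show "x powr \<theta> \<le> y"
    using assms by (simp add: powr_powr)
next
  assume "x powr \<theta> \<le> y"
  then have "(x powr \<theta>) powr (1 / \<theta>) \<le> y powr (1 / \<theta>)"
    using assms by (intro powr_mono2) auto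
  then show "x \<le> y powr (1 / \<theta>)"
    using assms by (simp add: powr_powr)
qed

section \<open>Assembly of parts (A), (B) and (C)\<close>

theorem proposition1:
  fixes g h :: "nat \<Rightarrow> real ^ 'n \<Rightarrow> real" and m p :: nat
  defines "F \<equiv> feasible_set m g p h"
    and "r \<equiv> residual m g p h"
    and "U \<equiv> residual_sublevel m g p h"
  assumes "\<And>i. i \<in> {1..m} \<Longrightarrow> C1_fun (g i)"
    and "\<And>j. j \<in> {1..p} \<Longrightarrow> C1_fun (h j)"
    and "F \<noteq> {}"
    and "has_bounding_constraint m g"
  shows "(compact F \<and> (\<forall>\<delta>\<ge>0. compact (U \<delta>))) \<and>
    (\<forall>\<delta>\<^sub>0>0. \<forall>\<theta>\<in>{0<..1}. \<forall>\<kappa>>0. residual_bound_on m g p h \<kappa> \<theta> (U \<delta>\<^sub>0) \<longrightarrow>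
      (\<forall>\<epsilon> \<beta> x\<^sub>c. 0 < \<epsilon> \<and> \<epsilon> \<le> \<beta> \<and> r x\<^sub>c \<le> \<delta>\<^sub>0 \<longrightarrow>
        (r x\<^sub>c \<le> (\<epsilon> / \<kappa>) powr (1 / \<theta>) \<longrightarrow> (\<exists>x'\<in>F. norm (x\<^sub>c - x') \<le> \<epsilon>)) \<and>
        (r x\<^sub>c \<le> (\<beta> / \<kappa>) powr (1 / \<theta>) \<longrightarrow>
           infdist x\<^sub>c F \<le> \<beta> \<and> (\<exists>y\<in>F. norm (x\<^sub>c - y) \<le> \<beta>)) \<and>
        (r x\<^sub>c > (\<beta> / \<kappa>) powr (1 / \<theta>) \<longrightarrow> \<kappa> * r x\<^sub>c powr \<theta> > \<beta>))) \<and>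
    (\<forall>x\<^sub>0\<in>F. MFCQ m g p h x\<^sub>0 \<longrightarrow>
      (\<exists>V. open V \<and> x\<^sub>0 \<in> V \<and> (\<exists>\<kappa>>0. \<forall>x\<in>V. infdist x F \<le> \<kappa> * r x))) \<and>
    ((\<forall>x\<^sub>0\<in>F. MFCQ m g p h x\<^sub>0) \<longrightarrow>
      (\<exists>V. open V \<and> F \<subseteq> V \<and> (\<exists>\<kappa>>0. \<forall>x\<in>V. infdist x F \<le> \<kappa> * r x)) \<and>
      (\<forall>\<delta>\<^sub>0>0. \<exists>\<kappa>>0. \<forall>x\<in>U \<delta>\<^sub>0. infdist x F \<le> \<kappa> * r x)) \<and>
    (\<forall>\<delta>\<^sub>0>0. \<forall>\<mu>>0. (\<forall>x\<in>U \<delta>\<^sub>0. r x \<ge> \<mu> * (infdist x F)\<^sup>2) \<longrightarrow>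
      residual_bound_on m g p h (\<mu> powr (- 1 / 2)) (1 / 2) (U \<delta>\<^sub>0))"
proof (intro conjI)
  note g = assms(4) and h = assms(5)
  have cont_r: "continuous_on S r" for S
    unfolding r_def by (intro continuous_on_residual C1_fun_continuous_on g h)
  have r_nonneg: "0 \<le> r x" for x
    by (simp add: r_def residual_nonneg)
  have compact_U: "compact (U \<delta>)" if "0 \<le> \<delta>" for \<delta>
  proof -
    have "closed (U \<delta>)"
      unfolding U_def residual_sublevel_def r_def[symmetric]
      by (intro closed_Collect_le cont_r continuous_on_const)
    then show ?thesis
      using bounded_residual_sublevel[OF assms(7) that] by (simp add: U_def compact_eq_bounded_closed)
  qed
  have "F = U 0"
    by (auto simp: F_def U_def residual_sublevel_def residual_le_iff feasible_set_def)
  then show "compact F"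
    using compact_U by simp
  show "\<forall>\<delta>\<ge>0. compact (U \<delta>)"
    using compact_U by blast
  \<comment> \<open>The infimum is attained because \<open>F\<close> is closed and nonempty, so a
    bound on the distance yields a feasible point at distance at most \<open>b\<close>, without
    extra slack.\<close>
  have attained: "\<exists>y\<in>F. norm (x - y) \<le> b" if "infdist x F \<le> b" for x b
  proof -
    obtain y where "y \<in> F" "infdist x F = dist x y"
      using infdist_attains_inf[OF compact_imp_closed[OF \<open>compact F\<close>] \<open>F \<noteq> {}\<close>] by blast
    with that show ?thesis
      by (metis dist_norm)
  qed
  show "\<forall>\<delta>\<^sub>0>0. \<forall>\<theta>\<in>{0<..1}. \<forall>\<kappa>>0. residual_bound_on m g p h \<kappa> \<theta> (U \<delta>\<^sub>0) \<longrightarrow>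
      (\<forall>\<epsilon> \<beta> x\<^sub>c. 0 < \<epsilon> \<and> \<epsilon> \<le> \<beta> \<and> r x\<^sub>c \<le> \<delta>\<^sub>0 \<longrightarrow>
        (r x\<^sub>c \<le> (\<epsilon> / \<kappa>) powr (1 / \<theta>) \<longrightarrow> (\<exists>x'\<in>F. norm (x\<^sub>c - x') \<le> \<epsilon>)) \<and>
        (r x\<^sub>c \<le> (\<beta> / \<kappa>) powr (1 / \<theta>) \<longrightarrow>
           infdist x\<^sub>c F \<le> \<beta> \<and> (\<exists>y\<in>F. norm (x\<^sub>c - y) \<le> \<beta>)) \<and>
        (r x\<^sub>c > (\<beta> / \<kappa>) powr (1 / \<theta>) \<longrightarrow> \<kappa> * r x\<^sub>c powr \<theta> > \<beta>))"
  proof (intro allI ballI impI, elim conjE)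
    fix \<delta>\<^sub>0 \<theta> \<kappa> \<epsilon> \<beta> :: real and x
    assume \<theta>: "\<theta> \<in> {0<..1}" and "0 < \<kappa>" and bound: "residual_bound_on m g p h \<kappa> \<theta> (U \<delta>\<^sub>0)"
      and "0 < \<epsilon>" "\<epsilon> \<le> \<beta>" and "r x \<le> \<delta>\<^sub>0"
    have threshold: "r x \<le> (b / \<kappa>) powr (1 / \<theta>) \<longleftrightarrow> \<kappa> * r x powr \<theta> \<le> b" if "0 < b" for b
      using le_powr_inverse_iff[of "r x" "b / \<kappa>" \<theta>] that \<theta> \<open>0 < \<kappa>\<close> r_nonneg
      by (simp add: field_simps)
    have "infdist x F \<le> \<kappa> * r x powr \<theta>"
      using bound \<open>r x \<le> \<delta>\<^sub>0\<close>
      by (simp add: residual_bound_on_def U_def residual_sublevel_def F_def r_def)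
    then have near: "infdist x F \<le> b" if "0 < b" "r x \<le> (b / \<kappa>) powr (1 / \<theta>)" for b
      using threshold that by force
    show "(r x \<le> (\<epsilon> / \<kappa>) powr (1 / \<theta>) \<longrightarrow> (\<exists>x'\<in>F. norm (x - x') \<le> \<epsilon>)) \<and>
        (r x \<le> (\<beta> / \<kappa>) powr (1 / \<theta>) \<longrightarrow>
           infdist x F \<le> \<beta> \<and> (\<exists>y\<in>F. norm (x - y) \<le> \<beta>)) \<and>
        (r x > (\<beta> / \<kappa>) powr (1 / \<theta>) \<longrightarrow> \<kappa> * r x powr \<theta> > \<beta>)"
    proof (intro conjI impI)
      have "0 < \<beta>"
        using \<open>0 < \<epsilon>\<close> \<open>\<epsilon> \<le> \<beta>\<close> by simp
      show "\<exists>x'\<in>F. norm (x - x') \<le> \<epsilon>" if "r x \<le> (\<epsilon> / \<kappa>) powr (1 / \<theta>)"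
        by (intro attained near \<open>0 < \<epsilon>\<close> that)
      show "infdist x F \<le> \<beta>" if "r x \<le> (\<beta> / \<kappa>) powr (1 / \<theta>)"
        by (intro near \<open>0 < \<beta>\<close> that)
      then show "\<exists>y\<in>F. norm (x - y) \<le> \<beta>" if "r x \<le> (\<beta> / \<kappa>) powr (1 / \<theta>)"
        using attained that by simp
      show "\<beta> < \<kappa> * r x powr \<theta>" if "(\<beta> / \<kappa>) powr (1 / \<theta>) < r x"
        using threshold[OF \<open>0 < \<beta>\<close>] that by linarith
    qed
  qed
  show local: "\<forall>x\<^sub>0\<in>F. MFCQ m g p h x\<^sub>0 \<longrightarrow>
      (\<exists>V. open V \<and> x\<^sub>0 \<in> V \<and> (\<exists>\<kappa>>0. \<forall>x\<in>V. infdist x F \<le> \<kappa> * r x))"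
    unfolding F_def r_def by (intro ballI impI MFCQ_local_error_bound g h)
  show "(\<forall>x\<^sub>0\<in>F. MFCQ m g p h x\<^sub>0) \<longrightarrow>
      (\<exists>V. open V \<and> F \<subseteq> V \<and> (\<exists>\<kappa>>0. \<forall>x\<in>V. infdist x F \<le> \<kappa> * r x)) \<and>
      (\<forall>\<delta>\<^sub>0>0. \<exists>\<kappa>>0. \<forall>x\<in>U \<delta>\<^sub>0. infdist x F \<le> \<kappa> * r x)"
  proof
    assume "\<forall>x\<^sub>0\<in>F. MFCQ m g p h x\<^sub>0"
    then have V: "\<exists>V. open V \<and> F \<subseteq> V \<and> (\<exists>\<kappa>>0. \<forall>x\<in>V. infdist x F \<le> \<kappa> * r x)"
      using local by (intro compact_local_bound_imp_uniform[OF \<open>compact F\<close> r_nonneg]) simp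
    then obtain V \<kappa> where "open V" "F \<subseteq> V" "0 < \<kappa>"
      and V_bound: "\<And>x. x \<in> V \<Longrightarrow> infdist x F \<le> \<kappa> * r x"
      by blast
    have extend: "\<exists>\<kappa>>0. \<forall>x\<in>U \<delta>\<^sub>0. infdist x F \<le> \<kappa> * r x" if "0 < \<delta>\<^sub>0" for \<delta>\<^sub>0
    proof (rule extend_bound_to_compact[OF _ _ cont_r r_nonneg \<open>open V\<close> \<open>0 < \<kappa>\<close> V_bound])
      show "compact (U \<delta>\<^sub>0)"
        using that by (intro compact_U) simp
      show "continuous_on (U \<delta>\<^sub>0) (\<lambda>x. infdist x F)"
        by (intro continuous_intros)
      show "0 < r x" if "x \<in> U \<delta>\<^sub>0 - V" for x
        using that \<open>F \<subseteq> V\<close> unfolding r_def residual_pos_iff F_def by blast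
    qed
    show "(\<exists>V. open V \<and> F \<subseteq> V \<and> (\<exists>\<kappa>>0. \<forall>x\<in>V. infdist x F \<le> \<kappa> * r x)) \<and>
      (\<forall>\<delta>\<^sub>0>0. \<exists>\<kappa>>0. \<forall>x\<in>U \<delta>\<^sub>0. infdist x F \<le> \<kappa> * r x)"
      using V by (intro conjI allI impI extend)
  qed
  show "\<forall>\<delta>\<^sub>0>0. \<forall>\<mu>>0. (\<forall>x\<in>U \<delta>\<^sub>0. r x \<ge> \<mu> * (infdist x F)\<^sup>2) \<longrightarrow>
      residual_bound_on m g p h (\<mu> powr (- 1 / 2)) (1 / 2) (U \<delta>\<^sub>0)"
    unfolding residual_bound_on_def F_def[symmetric] r_def[symmetric]
  proof (intro allI impI ballI)
    fix \<delta>\<^sub>0 \<mu> :: real and x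
    assume "0 < \<mu>" and "\<forall>x\<in>U \<delta>\<^sub>0. \<mu> * (infdist x F)\<^sup>2 \<le> r x" and "x \<in> U \<delta>\<^sub>0"
    \<comment> \<open>Divide the quadratic growth inequality by \<open>\<mu>\<close> and take square
      roots.\<close>
    then have "infdist x F \<le> sqrt (r x / \<mu>)"
      by (intro real_le_rsqrt) (simp add: field_simps)
    \<comment> \<open>The identity includes feasible points: at \<open>r x = 0\<close> both sides
      vanish, since \<open>0 powr (1 / 2) = 0\<close>.\<close>
    also have "\<dots> = \<mu> powr (- 1 / 2) * r x powr (1 / 2)"
      using \<open>0 < \<mu>\<close> r_nonneg[of x]
      by (simp add: real_sqrt_divide powr_minus_divide powr_half_sqrt)
    finally show "infdist x F \<le> \<mu> powr (- 1 / 2) * r x powr (1 / 2)" .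
  qed
qed

end
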